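(* Let $(G_1,\oplus_1,\otimes_1,\phi_1)$ and $(G_2,\oplus_2,\otimes_2,\phi_2)$ be generalized gyrovector spaces, with gyrometrics $\varrho_1$ and $\varrho_2$ respectively, and let $\boldsymbol{e}_1$ be the unit of $G_1$. Suppose that $T\colon G_1\to G_2$ is a surjection satisfying $\varrho_2(T\boldsymbol{a},T\boldsymbol{b})=\varrho_1(\boldsymbol{a},\boldsymbol{b})$ for every pair $\boldsymbol{a},\boldsymbol{b}\in G_1$. Then $T$ is of the form $T=T(\boldsymbol{e}_1)\oplus_2 T_0$ (that is, $T(\boldsymbol{a})=T(\boldsymbol{e}_1)\oplus_2T_0(\boldsymbol{a})$ for all $\boldsymbol{a}\in G_1$), where $T_0\colon G_1\to G_2$ is an isometrical isomorphism in the sense that it is a bijection such that, for all $\boldsymbol{a},\boldsymbol{b}\in G_1$ and $\alpha\in\mathbb{R}$, $$T_0(\boldsymbol{a}\oplus_1\boldsymbol{b})=T_0(\boldsymbol{a})\oplus_2T_0(\boldsymbol{b}),\qquad T_0(\alpha\otimes_1\boldsymbol{a})=\alpha\otimes_2T_0(\boldsymbol{a}),\qquad \varrho_2(T_0(\boldsymbol{a}),T_0(\boldsymbol{b}))=\varrho_1(\boldsymbol{a},\boldsymbol{b}).$$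
   Context: Gyrogroups. A gyrogroup $(G,\oplus)$ is a nonempty set with a binary operation $\oplus$ such that: there is $\boldsymbol{e}\in G$ (the unit) with $\boldsymbol{e}\oplus\boldsymbol{a}=\boldsymbol{a}$ for all $\boldsymbol{a}$; each $\boldsymbol{a}$ has an element $\ominus\boldsymbol{a}$ with $\ominus\boldsymbol{a}\oplus\boldsymbol{a}=\boldsymbol{e}$; for all $\boldsymbol{a},\boldsymbol{b}$ there is a map $\operatorname{gyr}[\boldsymbol{a},\boldsymbol{b}]\colon G\to G$, which is an automorphism of $(G,\oplus)$, such that $\boldsymbol{a}\oplus(\boldsymbol{b}\oplus\boldsymbol{c})=(\boldsymbol{a}\oplus\boldsymbol{b})\oplus\operatorname{gyr}[\boldsymbol{a},\boldsymbol{b}]\boldsymbol{c}$ for all $\boldsymbol{c}$ (and $\operatorname{gyr}[\boldsymbol a,\boldsymbol b]\boldsymbol c$ is the unique element with this property); and $\operatorname{gyr}[\boldsymbol{a}\oplus\boldsymbol{b},\boldsymbol{b}]=\operatorname{gyr}[\boldsymbol{a},\boldsymbol{b}]$. It is gyrocommutative if $\boldsymbol{a}\oplus\boldsymbol{b}=\operatorname{gyr}[\boldsymbol{a},\boldsymbol{b}](\boldsymbol{b}\oplus\boldsymbol{a})$ for all $\boldsymbol{a},\boldsymbol{b}$. Write $\boldsymbol{a}\ominus\boldsymbol{b}=\boldsymbol{a}\oplus(\ominus\boldsymbol{b})$. Generalized gyrovector space (GGV). Let $(G,\oplus)$ be a gyrocommutative gyrogroup with unit $\boldsymbol{e}$,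 with a map $\otimes\colon\mathbb{R}\times G\to G$, and let $\phi$ be an injection from $G$ into a real normed space $(\mathbb{V},\|\cdot\|)$. Then $(G,\oplus,\otimes,\phi)$ (also written $(G,\oplus,\otimes)$) is a GGV if: (GGV0) $\|\phi(\operatorname{gyr}[\boldsymbol{u},\boldsymbol{v}]\boldsymbol{a})\|=\|\phi(\boldsymbol{a})\|$ for all $\boldsymbol{u},\boldsymbol{v},\boldsymbol{a}\in G$; (GGV1) $1\otimes\boldsymbol{a}=\boldsymbol{a}$ for all $\boldsymbol{a}\in G$; (GGV2) $(r_1+r_2)\otimes\boldsymbol{a}=(r_1\otimes\boldsymbol{a})\oplus(r_2\otimes\boldsymbol{a})$ for all $\boldsymbol{a}\in G$, $r_1,r_2\in\mathbb{R}$; (GGV3) $(r_1r_2)\otimes\boldsymbol{a}=r_1\otimes(r_2\otimes\boldsymbol{a})$ for all $\boldsymbol{a}\in G$, $r_1,r_2\in\mathbb{R}$; (GGV4) $\phi(|r|\otimes\boldsymbol{a})/\|\phi(r\otimes\boldsymbol{a})\|=\phi(\boldsymbol{a})/\|\phi(\boldsymbol{a})\|$ for all $\boldsymbol{a}\in G\setminus\{\boldsymbol{e}\}$, $r\in\mathbb{R}\setminus\{0\}$ (the denominators are automatically nonzero given the other conditions); (GGV5) $\operatorname{gyr}[\boldsymbol{u},\boldsymbol{v}](r\otimes\boldsymbol{a})=r\otimes\operatorname{gyr}[\boldsymbol{u},\boldsymbol{v}]\boldsymbol{a}$ for all $\boldsymbol{u},\boldsymbol{v},\boldsymbol{a}\in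 G$, $r\in\mathbb{R}$; (GGV6) $\operatorname{gyr}[r_1\otimes\boldsymbol{v},r_2\otimes\boldsymbol{v}]=\mathrm{id}_G$ for all $\boldsymbol{v}\in G$, $r_1,r_2\in\mathbb{R}$; (GGVV) the set $\|\phi(G)\|=\{\pm\|\phi(\boldsymbol{a})\|\in\mathbb{R}:\boldsymbol{a}\in G\}$ is a real linear space of dimension one with some vector addition $\oplus'$ and scalar multiplication $\otimes'$ (part of the data, not necessarily the usual operations of $\mathbb{R}$); (GGV7) $\|\phi(r\otimes\boldsymbol{a})\|=|r|\otimes'\|\phi(\boldsymbol{a})\|$ for all $\boldsymbol{a}\in G$, $r\in\mathbb{R}$; (GGV8) $\|\phi(\boldsymbol{a}\oplus\boldsymbol{b})\|\le\|\phi(\boldsymbol{a})\|\oplus'\|\phi(\boldsymbol{b})\|$ for all $\boldsymbol{a},\boldsymbol{b}\in G$, where $\le$ is the usual order of $\mathbb{R}$. The gyrometric of a GGV is $\varrho(\boldsymbol{a},\boldsymbol{b})=\|\phi(\boldsymbol{a}\ominus\boldsymbol{b})\|$. *)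

theory Defs
  imports Complex_Main "Jordan_Normal_Form.VS_Connect"
begin

locale gyrogroup =
  fixes G :: "'a set"
    and gadd :: "'a \<Rightarrow> 'a \<Rightarrow> 'a" (infixl "\<oplus>\<^sub>g" 65)
    and unit :: "'a" ("\<e>")
    and gneg :: "'a \<Rightarrow> 'a" ("\<ominus>\<^sub>g _" [81] 80)
    and gyr :: "'a \<Rightarrow> 'a \<Rightarrow> 'a \<Rightarrow> 'a"
  assumes gadd_closed: "\<And>a b. \<lbrakk>a \<in> G; b \<in> G\<rbrakk> \<Longrightarrow> a \<oplus>\<^sub>g b \<in> G"
    and unit_closed: "\<e> \<in> G"
    and left_unit: "\<And>a. a \<in> G \<Longrightarrow> \<e> \<oplus>\<^sub>g a = a"
    and gneg_closed: "\<And>a. a \<in> G \<Longrightarrow> \<ominus>\<^sub>g a \<in> G"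
    and left_inverse: "\<And>a. a \<in> G \<Longrightarrow> \<ominus>\<^sub>g a \<oplus>\<^sub>g a = \<e>"
    and gyr_bij: "\<And>a b. \<lbrakk>a \<in> G; b \<in> G\<rbrakk> \<Longrightarrow> bij_betw (gyr a b) G G"
    and gyr_gadd: "\<And>a b c d. \<lbrakk>a \<in> G; b \<in> G; c \<in> G; d \<in> G\<rbrakk> \<Longrightarrow>
          gyr a b (c \<oplus>\<^sub>g d) = gyr a b c \<oplus>\<^sub>g gyr a b d"
    and left_gyroassoc: "\<And>a b c. \<lbrakk>a \<in> G; b \<in> G; c \<in> G\<rbrakk> \<Longrightarrow>
          a \<oplus>\<^sub>g (b \<oplus>\<^sub>g c) = (a \<oplus>\<^sub>g b) \<oplus>\<^sub>g gyr a b c"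
    and gyr_unique: "\<And>a b c d. \<lbrakk>a \<in> G; b \<in> G; c \<in> G; d \<in> G;
          a \<oplus>\<^sub>g (b \<oplus>\<^sub>g c) = (a \<oplus>\<^sub>g b) \<oplus>\<^sub>g d\<rbrakk> \<Longrightarrow> d = gyr a b c"
    and left_loop: "\<And>a b c. \<lbrakk>a \<in> G; b \<in> G; c \<in> G\<rbrakk> \<Longrightarrow>
          gyr (a \<oplus>\<^sub>g b) b c = gyr a b c"

locale gyrocommutative_gyrogroup = gyrogroup +
  assumes gyrocomm: "\<And>a b. \<lbrakk>a \<in> G; b \<in> G\<rbrakk> \<Longrightarrow> a \<oplus>\<^sub>g b = gyr a b (b \<oplus>\<^sub>g a)"

(* The one-dimensional space on the set of signed norms is the record V: its addition and
   scalar multiplication are the primed operations, independent of those of the reals; the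
   multiplicative fields of the record are unused. Finite dimensionality is stated separately
   because dim is an unspecified number without it.
   In ggv4 the totalised quotient x / 0 = 0 does no harm: the remaining axioms imply that
   both denominators are nonzero. *)
locale ggv = gyrocommutative_gyrogroup G gadd unit gneg gyr
  for G :: "'a set"
    and gadd :: "'a \<Rightarrow> 'a \<Rightarrow> 'a" (infixl "\<oplus>\<^sub>g" 65)
    and unit :: "'a" ("\<e>")
    and gneg :: "'a \<Rightarrow> 'a" ("\<ominus>\<^sub>g _" [81] 80)
    and gyr :: "'a \<Rightarrow> 'a \<Rightarrow> 'a \<Rightarrow> 'a" +
  fixes gscale :: "real \<Rightarrow> 'a \<Rightarrow> 'a" (infixr "\<otimes>\<^sub>g" 75)
    and \<phi> :: "'a \<Rightarrow> 'v :: real_normed_vector"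
    and V :: "(real, real) module"
  assumes gscale_closed: "\<And>r a. a \<in> G \<Longrightarrow> r \<otimes>\<^sub>g a \<in> G"
    and inj_phi: "inj_on \<phi> G"
    and ggv0: "\<And>u v a. \<lbrakk>u \<in> G; v \<in> G; a \<in> G\<rbrakk> \<Longrightarrow> norm (\<phi> (gyr u v a)) = norm (\<phi> a)"
    and ggv1: "\<And>a. a \<in> G \<Longrightarrow> 1 \<otimes>\<^sub>g a = a"
    and ggv2: "\<And>r s a. a \<in> G \<Longrightarrow> (r + s) \<otimes>\<^sub>g a = (r \<otimes>\<^sub>g a) \<oplus>\<^sub>g (s \<otimes>\<^sub>g a)"
    and ggv3: "\<And>r s a. a \<in> G \<Longrightarrow> (r * s) \<otimes>\<^sub>g a = r \<otimes>\<^sub>g (s \<otimes>\<^sub>g a)"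
    and ggv4: "\<And>r a. \<lbrakk>a \<in> G; a \<noteq> \<e>; r \<noteq> 0\<rbrakk> \<Longrightarrow>
          \<phi> (\<bar>r\<bar> \<otimes>\<^sub>g a) /\<^sub>R norm (\<phi> (r \<otimes>\<^sub>g a)) = \<phi> a /\<^sub>R norm (\<phi> a)"
    and ggv5: "\<And>u v r a. \<lbrakk>u \<in> G; v \<in> G; a \<in> G\<rbrakk> \<Longrightarrow> gyr u v (r \<otimes>\<^sub>g a) = r \<otimes>\<^sub>g gyr u v a"
    and ggv6: "\<And>r s v a. \<lbrakk>v \<in> G; a \<in> G\<rbrakk> \<Longrightarrow> gyr (r \<otimes>\<^sub>g v) (s \<otimes>\<^sub>g v) a = a"
    and ggvv_carrier: "carrier V = (\<Union>a\<in>G. {norm (\<phi> a), - norm (\<phi> a)})"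
    and ggvv_vectorspace: "vectorspace class_field V"
    and ggvv_fin_dim: "vectorspace.fin_dim class_field V"
    and ggvv_dim: "vectorspace.dim class_field V = 1"
    and ggv7: "\<And>r a. a \<in> G \<Longrightarrow> norm (\<phi> (r \<otimes>\<^sub>g a)) = \<bar>r\<bar> \<odot>\<^bsub>V\<^esub> norm (\<phi> a)"
    and ggv8: "\<And>a b. \<lbrakk>a \<in> G; b \<in> G\<rbrakk> \<Longrightarrow>
          norm (\<phi> (a \<oplus>\<^sub>g b)) \<le> norm (\<phi> a) \<oplus>\<^bsub>V\<^esub> norm (\<phi> b)"
begin

definition gyrometric :: "'a \<Rightarrow> 'a \<Rightarrow> real" ("\<rho>") where
  "\<rho> a b = norm (\<phi> (a \<oplus>\<^sub>g (\<ominus>\<^sub>g b)))"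

end

end

theory Submission
  imports Defs
begin

text \<open>The axioms force the coordinate of \<open>norm (\<phi> a)\<close> in the line \<open>V\<close> to be a nonnegative
  strictly increasing function of \<open>norm (\<phi> a)\<close>; this coordinate is an honest real-valued norm \<open>N\<close>
  with triangle inequality and homogeneity, although \<open>V\<close> has exotic operations. For the point
  reflection \<open>x \<mapsto> z \<oplus> (z \<ominus> x)\<close>, which is an isometry moving \<open>x\<close> by \<open>2 N (x \<ominus> z)\<close>, Vaisala's
  proof of the Mazur-Ulam theorem shows that \<open>T\<close> commutes with reflections. The coordinate norms
  of the two spaces need not correspond under \<open>T\<close>, but that proof only uses isometries of \<open>G1\<close>.
  Addition is recovered from reflections, rational homogeneity from addition, and real homogeneity
  from monotonicity of the norms.\<close>

section \<open>Cancellation, inverses and differences in a gyrogroup\<close>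

context gyrogroup
begin

lemma gyr_closed [simp]: "\<lbrakk>a \<in> G; b \<in> G; c \<in> G\<rbrakk> \<Longrightarrow> gyr a b c \<in> G"
  using gyr_bij bij_betw_apply by metis

lemmas closed [simp] = gadd_closed unit_closed gneg_closed

declare left_unit [simp] left_inverse [simp]

lemma gyr_inject: "\<lbrakk>a \<in> G; b \<in> G; c \<in> G; d \<in> G\<rbrakk> \<Longrightarrow> gyr a b c = gyr a b d \<longleftrightarrow> c = d"
  using gyr_bij by (meson bij_betw_imp_inj_on inj_on_eq_iff)

lemma gyr_unit_left [simp]: "\<lbrakk>b \<in> G; c \<in> G\<rbrakk> \<Longrightarrow> gyr \<e> b c = c"
  using gyr_unique[of \<e> b c c] by simp

text \<open>The left loop property identifies \<open>gyr (\<ominus>\<^sub>g a) a\<close> with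
  \<open>gyr \<e> a\<close>, the identity, so this particular sum may be rebracketed freely.\<close>

lemma left_cancellation [simp]: "\<lbrakk>a \<in> G; b \<in> G\<rbrakk> \<Longrightarrow> \<ominus>\<^sub>g a \<oplus>\<^sub>g (a \<oplus>\<^sub>g b) = b"
  using left_gyroassoc[of "\<ominus>\<^sub>g a" a b] left_loop[of "\<ominus>\<^sub>g a" a b] by simp

lemma gadd_left_inject: "\<lbrakk>a \<in> G; b \<in> G; c \<in> G\<rbrakk> \<Longrightarrow> a \<oplus>\<^sub>g b = a \<oplus>\<^sub>g c \<longleftrightarrow> b = c"
  using left_cancellation by metis

text \<open>Cancelling shows that \<open>a\<close> and \<open>a \<oplus>\<^sub>g \<e>\<close> both
  equal the double inverse of \<open>a\<close> plus the unit.\<close>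

lemma right_unit [simp]: "a \<in> G \<Longrightarrow> a \<oplus>\<^sub>g \<e> = a"
  using left_cancellation[of "\<ominus>\<^sub>g a" a] left_cancellation[of "\<ominus>\<^sub>g a" "a \<oplus>\<^sub>g \<e>"] by simp

lemma gneg_gneg [simp]: "a \<in> G \<Longrightarrow> \<ominus>\<^sub>g (\<ominus>\<^sub>g a) = a"
  using left_cancellation[of "\<ominus>\<^sub>g a" a] by simp

lemma right_inverse [simp]: "a \<in> G \<Longrightarrow> a \<oplus>\<^sub>g (\<ominus>\<^sub>g a) = \<e>"
  using left_inverse[of "\<ominus>\<^sub>g a"] by simp

lemma left_cancellation' [simp]: "\<lbrakk>a \<in> G; b \<in> G\<rbrakk> \<Longrightarrow> a \<oplus>\<^sub>g (\<ominus>\<^sub>g a \<oplus>\<^sub>g b) = b"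
  using left_cancellation[of "\<ominus>\<^sub>g a" b] by simp

lemma gneg_unit [simp]: "\<ominus>\<^sub>g \<e> = \<e>"
  using right_unit[of "\<ominus>\<^sub>g \<e>"] left_inverse[of \<e>] by (metis unit_closed gneg_closed)

lemma gneg_unique: "\<lbrakk>a \<in> G; b \<in> G; a \<oplus>\<^sub>g b = \<e>\<rbrakk> \<Longrightarrow> b = \<ominus>\<^sub>g a"
  using left_cancellation[of a b] by simp

lemma gadd_gneg_eq_unit: "\<lbrakk>a \<in> G; b \<in> G\<rbrakk> \<Longrightarrow> a \<oplus>\<^sub>g (\<ominus>\<^sub>g b) = \<e> \<longleftrightarrow> a = b"
  using gneg_unique[of a "\<ominus>\<^sub>g b"] gneg_gneg right_inverse by (metis gneg_closed)

lemma gyr_unit [simp]: "\<lbrakk>a \<in> G; b \<in> G\<rbrakk> \<Longrightarrow> gyr a b \<e> = \<e>"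
  using gyr_gadd[of a b \<e> \<e>] gadd_left_inject[of "gyr a b \<e>" "gyr a b \<e>" \<e>] by simp

lemma gyr_gneg: "\<lbrakk>a \<in> G; b \<in> G; c \<in> G\<rbrakk> \<Longrightarrow> gyr a b (\<ominus>\<^sub>g c) = \<ominus>\<^sub>g (gyr a b c)"
  using gyr_gadd[of a b c "\<ominus>\<^sub>g c"] by (intro gneg_unique) auto

text \<open>Write \<open>y\<close> as \<open>x\<close> plus
  \<open>\<ominus>\<^sub>g x \<oplus>\<^sub>g y\<close> and rebracket: a left translation alters
  differences only by a gyration, which preserves norms by (GGV0).\<close>

lemma left_difference:
  assumes "a \<in> G" "x \<in> G" "y \<in> G"
  shows "\<ominus>\<^sub>g (a \<oplus>\<^sub>g x) \<oplus>\<^sub>g (a \<oplus>\<^sub>g y) = gyr a x (\<ominus>\<^sub>g x \<oplus>\<^sub>g y)"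
proof -
  have "a \<oplus>\<^sub>g y = (a \<oplus>\<^sub>g x) \<oplus>\<^sub>g gyr a x (\<ominus>\<^sub>g x \<oplus>\<^sub>g y)"
    using left_gyroassoc[of a x "\<ominus>\<^sub>g x \<oplus>\<^sub>g y"] assms by simp
  then show ?thesis using assms by simp
qed

text \<open>The analogue of \<open>2 z - x\<close>. This bracketing exhibits it as inversion
  followed by two left translations, from which isometry and involutivity can be read off.\<close>

definition reflection :: "'a \<Rightarrow> 'a \<Rightarrow> 'a" where
  "reflection z x = z \<oplus>\<^sub>g (z \<oplus>\<^sub>g (\<ominus>\<^sub>g x))"

lemma reflection_closed [simp]: "\<lbrakk>z \<in> G; x \<in> G\<rbrakk> \<Longrightarrow> reflection z x \<in> G"
  by (simp add: reflection_def)

lemma reflection_self [simp]: "z \<in> G \<Longrightarrow> reflection z z = z"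
  by (simp add: reflection_def)

end

section \<open>Inverses of sums and differences of translates under gyrocommutativity\<close>

context gyrocommutative_gyrogroup
begin

text \<open>Both sides have the same image \<open>\<ominus>\<^sub>g (b \<oplus>\<^sub>g a)\<close>
  under the injective map \<open>gyr b a\<close>: one by \<open>left_difference\<close>, the other
  by gyrocommutativity.\<close>

lemma automorphic_inverse:
  assumes "a \<in> G" "b \<in> G"
  shows "\<ominus>\<^sub>g (a \<oplus>\<^sub>g b) = \<ominus>\<^sub>g a \<oplus>\<^sub>g (\<ominus>\<^sub>g b)"
proof -
  have "\<ominus>\<^sub>g (b \<oplus>\<^sub>g a) = gyr b a (\<ominus>\<^sub>g a \<oplus>\<^sub>g (\<ominus>\<^sub>g b))"
    using left_difference[of b a "\<ominus>\<^sub>g b"] assms by simp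
  moreover have "\<ominus>\<^sub>g (b \<oplus>\<^sub>g a) = gyr b a (\<ominus>\<^sub>g (a \<oplus>\<^sub>g b))"
    using gyrocomm[of b a] assms by (simp add: gyr_gneg)
  ultimately show ?thesis
    using gyr_inject[of b a "\<ominus>\<^sub>g a \<oplus>\<^sub>g (\<ominus>\<^sub>g b)" "\<ominus>\<^sub>g (a \<oplus>\<^sub>g b)"] assms by simp
qed

text \<open>Taking inverses brings \<open>left_difference\<close> to the order of terms used by the
  gyrometric.\<close>

lemma left_translation_difference:
  assumes "a \<in> G" "x \<in> G" "y \<in> G"
  shows "(a \<oplus>\<^sub>g x) \<oplus>\<^sub>g (\<ominus>\<^sub>g (a \<oplus>\<^sub>g y)) = gyr a x (x \<oplus>\<^sub>g (\<ominus>\<^sub>g y))"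
proof -
  have "(a \<oplus>\<^sub>g x) \<oplus>\<^sub>g (\<ominus>\<^sub>g (a \<oplus>\<^sub>g y)) = \<ominus>\<^sub>g (\<ominus>\<^sub>g (a \<oplus>\<^sub>g x) \<oplus>\<^sub>g (a \<oplus>\<^sub>g y))"
    using assms by (simp add: automorphic_inverse)
  also have "\<dots> = gyr a x (\<ominus>\<^sub>g (\<ominus>\<^sub>g x \<oplus>\<^sub>g y))"
    using assms by (simp add: left_difference gyr_gneg)
  also have "\<ominus>\<^sub>g (\<ominus>\<^sub>g x \<oplus>\<^sub>g y) = x \<oplus>\<^sub>g (\<ominus>\<^sub>g y)"
    using assms by (simp add: automorphic_inverse)
  finally show ?thesis .
qed

lemma reflection_reflection [simp]:
  assumes "z \<in> G" "x \<in> G"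
  shows "reflection z (reflection z x) = x"
  using assms by (simp add: reflection_def automorphic_inverse)

end

section \<open>Isometries and midpoints in a generalized gyrovector space\<close>

context ggv
begin

declare gscale_closed [simp]

lemma scale_zero [simp]:
  assumes "a \<in> G"
  shows "0 \<otimes>\<^sub>g a = \<e>"
  using ggv2[of a 0 0] gadd_left_inject[of "0 \<otimes>\<^sub>g a" "0 \<otimes>\<^sub>g a" \<e>] assms by simp

lemma scale_unit [simp]: "r \<otimes>\<^sub>g \<e> = \<e>"
  using ggv3[of \<e> r 0] by simp

lemma scale_neg_one: "a \<in> G \<Longrightarrow> (-1) \<otimes>\<^sub>g a = \<ominus>\<^sub>g a"
  using ggv2[of a 1 "-1"] ggv1[of a] by (intro gneg_unique) auto

lemma scale_two: "a \<in> G \<Longrightarrow> 2 \<otimes>\<^sub>g a = a \<oplus>\<^sub>g a"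
  using ggv2[of a 1 1] ggv1[of a] by simp

lemma norm_gneg [simp]: "a \<in> G \<Longrightarrow> norm (\<phi> (\<ominus>\<^sub>g a)) = norm (\<phi> a)"
  using ggv7[of a "-1"] ggv7[of a 1] ggv1[of a] by (simp add: scale_neg_one)

lemma gyr_self [simp]: "\<lbrakk>a \<in> G; b \<in> G\<rbrakk> \<Longrightarrow> gyr a a b = b"
  using ggv6[of a b 1 1] ggv1[of a] by simp

lemma gyrometric_left_translation:
  assumes "a \<in> G" "x \<in> G" "y \<in> G"
  shows "\<rho> (a \<oplus>\<^sub>g x) (a \<oplus>\<^sub>g y) = \<rho> x y"
  unfolding gyrometric_def using assms by (simp add: left_translation_difference ggv0)

lemma gyrometric_gneg:
  assumes "x \<in> G" "y \<in> G"
  shows "\<rho> (\<ominus>\<^sub>g x) (\<ominus>\<^sub>g y) = \<rho> x y"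
  unfolding gyrometric_def using assms norm_gneg[of "x \<oplus>\<^sub>g (\<ominus>\<^sub>g y)"]
  by (simp add: automorphic_inverse)

lemma gyrometric_reflection:
  assumes "z \<in> G" "x \<in> G" "y \<in> G"
  shows "\<rho> (reflection z x) (reflection z y) = \<rho> x y"
  unfolding reflection_def using assms by (simp add: gyrometric_left_translation gyrometric_gneg)

lemma exists_reflection:
  assumes "a \<in> G" "b \<in> G"
  shows "\<exists>z\<in>G. reflection z a = b"
proof
  \<comment> \<open>The midpoint is reached by going from \<open>a\<close> half of the way along
    \<open>\<ominus>\<^sub>g a \<oplus>\<^sub>g b\<close>. Its differences to both endpoints turn
    out to be the same gyration of \<open>w\<close>.\<close>
  define w where "w = (1/2) \<otimes>\<^sub>g (\<ominus>\<^sub>g a \<oplus>\<^sub>g b)"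
  define z where "z = a \<oplus>\<^sub>g w"
  have w: "w \<in> G" using assms by (simp add: w_def)
  then show z: "a \<oplus>\<^sub>g w \<in> G" using assms by simp
  have "w \<oplus>\<^sub>g w = \<ominus>\<^sub>g a \<oplus>\<^sub>g b"
    using ggv3[of "\<ominus>\<^sub>g a \<oplus>\<^sub>g b" 2 "1/2"] scale_two[OF w] assms by (simp add: w_def ggv1)
  then have b: "b = a \<oplus>\<^sub>g (w \<oplus>\<^sub>g w)" using assms by simp
  have "\<ominus>\<^sub>g z \<oplus>\<^sub>g b = gyr a w w"
    unfolding z_def b using left_difference[of a w "w \<oplus>\<^sub>g w"] assms w by simp
  moreover have "z \<oplus>\<^sub>g (\<ominus>\<^sub>g a) = gyr a w w"
    unfolding z_def using left_translation_difference[of a w \<e>] assms w by simp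
  ultimately have "z \<oplus>\<^sub>g (z \<oplus>\<^sub>g (\<ominus>\<^sub>g a)) = b"
    using left_cancellation'[of z b] z assms by (simp add: z_def)
  then show "reflection (a \<oplus>\<^sub>g w) a = b" by (simp add: reflection_def z_def)
qed

section \<open>The line of norms and the real-valued norm obtained from it\<close>

lemma scalar_coordinate:
  assumes x: "x \<in> carrier V" "x \<noteq> \<zero>\<^bsub>V\<^esub>" and y: "y \<in> carrier V"
  obtains r where "y = r \<odot>\<^bsub>V\<^esub> x"
proof -
  interpret V: vectorspace "class_field :: real ring" V by (rule ggvv_vectorspace)
  \<comment> \<open>A single nonzero vector is independent, and in dimension one it is therefore a
    basis.\<close>
  have "V.lin_indpt {x}"
  proof
    assume "V.lin_dep {x}"
    then obtain a where a: "V.lincomb a {x} = \<zero>\<^bsub>V\<^esub>" "a x \<noteq> (0::real)"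
      using V.finite_lin_dep[of "{x}"] x by (auto simp: class_field_def)
    then have "a x \<odot>\<^bsub>V\<^esub> x = \<zero>\<^bsub>V\<^esub>"
      using x by (simp add: V.lincomb_def class_field_def)
    then have "inverse (a x) \<odot>\<^bsub>V\<^esub> (a x \<odot>\<^bsub>V\<^esub> x) = \<zero>\<^bsub>V\<^esub>"
      by (simp add: class_field_def)
    then show False
      using V.smult_assoc1[of "inverse (a x)" "a x" x] V.smult_one[of x] a x
      by (simp add: class_field_def)
  qed
  then have "V.basis {x}"
    using V.dim_li_is_basis[of "{x}"] x ggvv_fin_dim ggvv_dim by simp
  then have "y \<in> V.span {x}" using y by (simp add: V.basis_def)
  then obtain a where "y = V.lincomb a {x}"
    using V.finite_span[of "{x}"] x by auto
  then show ?thesis using that x by (simp add: V.lincomb_def class_field_def)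
qed

lemma norm_phi_carrier: "a \<in> G \<Longrightarrow> norm (\<phi> a) \<in> carrier V"
  using ggvv_carrier by blast

text \<open>(GGV7) with scalar 0 at the unit; the zero of \<open>V\<close> is identified through the
  unit and not through the real number 0.\<close>

lemma zero_V: "\<zero>\<^bsub>V\<^esub> = norm (\<phi> \<e>)"
proof -
  interpret V: vectorspace "class_field :: real ring" V by (rule ggvv_vectorspace)
  have "0 \<odot>\<^bsub>V\<^esub> norm (\<phi> \<e>) = \<zero>\<^bsub>V\<^esub>"
    using V.smult_l_null[of "norm (\<phi> \<e>)"] norm_phi_carrier by (simp add: class_field_def)
  then show ?thesis using ggv7[of \<e> 0] by simp
qed

text \<open>Doubling fixes the norm of the unit, hence that of \<open>c\<close>. Then (GGV4) with
  \<open>r = 2\<close> gives \<open>2 \<otimes>\<^sub>g c\<close> and \<open>c\<close> the same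
  image under \<open>\<phi>\<close>, so injectivity yields
  \<open>c \<oplus>\<^sub>g c = c\<close>.\<close>

lemma norm_phi_eq_unit:
  assumes "c \<in> G" "norm (\<phi> c) = norm (\<phi> \<e>)"
  shows "c = \<e>"
proof (rule ccontr)
  assume c: "c \<noteq> \<e>"
  have "norm (\<phi> (2 \<otimes>\<^sub>g c)) = norm (\<phi> c)"
    using ggv7[of c 2] ggv7[of \<e> 2] assms by simp
  then have "norm (\<phi> c) \<noteq> 0 \<Longrightarrow> \<phi> (2 \<otimes>\<^sub>g c) = \<phi> c"
    using ggv4[of c 2] assms c by simp
  moreover have "norm (\<phi> c) \<noteq> 0"
    using assms c inj_onD[OF inj_phi, of c \<e>] by auto
  ultimately have "c \<oplus>\<^sub>g c = c \<oplus>\<^sub>g \<e>"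
    using inj_phi assms by (simp add: inj_on_eq_iff scale_two)
  then show False using c assms gadd_left_inject[of c c \<e>] by simp
qed

lemma gyrometric_eq_norm_unit:
  assumes "a \<in> G" "b \<in> G"
  shows "\<rho> a b = norm (\<phi> \<e>) \<longleftrightarrow> a = b"
  unfolding gyrometric_def
  using norm_phi_eq_unit[of "a \<oplus>\<^sub>g (\<ominus>\<^sub>g b)"] gadd_gneg_eq_unit[of a b] assms by auto

lemma norm_phi_scale_mono:
  assumes "a \<in> G" "0 \<le> t" "t \<le> u"
  shows "norm (\<phi> (t \<otimes>\<^sub>g a)) \<le> norm (\<phi> (u \<otimes>\<^sub>g a))"
proof -
  interpret V: vectorspace "class_field :: real ring" V by (rule ggvv_vectorspace)
  \<comment> \<open>Since \<open>s\<close> is nonpositive, \<open>t\<close> is the sum of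
    \<open>r\<close> and \<open>s\<close> while \<open>u\<close> is the sum of their absolute
    values; (GGV8) compares exactly these two.\<close>
  define r s where "r = (t + u) / 2" and "s = (t - u) / 2"
  have rs: "r + s = t" "\<bar>r\<bar> + \<bar>s\<bar> = u" using assms by (auto simp: r_def s_def field_simps)
  have "norm (\<phi> (t \<otimes>\<^sub>g a)) \<le> norm (\<phi> (r \<otimes>\<^sub>g a)) \<oplus>\<^bsub>V\<^esub> norm (\<phi> (s \<otimes>\<^sub>g a))"
    using ggv2[of a r s] ggv8[of "r \<otimes>\<^sub>g a" "s \<otimes>\<^sub>g a"] assms rs by simp
  also have "\<dots> = (\<bar>r\<bar> + \<bar>s\<bar>) \<odot>\<^bsub>V\<^esub> norm (\<phi> a)"
    using V.smult_l_distr[of "\<bar>r\<bar>" "\<bar>s\<bar>" "norm (\<phi> a)"] norm_phi_carrier assms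
    by (simp add: ggv7 class_field_def)
  also have "\<dots> = norm (\<phi> (u \<otimes>\<^sub>g a))"
    using assms rs by (simp add: ggv7)
  finally show ?thesis .
qed

lemma norm_phi_scale_inject:
  assumes "a \<in> G" "a \<noteq> \<e>" and eq: "r \<odot>\<^bsub>V\<^esub> norm (\<phi> a) = s \<odot>\<^bsub>V\<^esub> norm (\<phi> a)"
  shows "r = s"
proof (rule ccontr)
  interpret V: vectorspace "class_field :: real ring" V by (rule ggvv_vectorspace)
  let ?x = "norm (\<phi> a)"
  have x: "?x \<in> carrier V" using assms norm_phi_carrier by simp
  assume "r \<noteq> s"
  have "(r - s) \<odot>\<^bsub>V\<^esub> ?x = r \<odot>\<^bsub>V\<^esub> ?x \<oplus>\<^bsub>V\<^esub> (- s) \<odot>\<^bsub>V\<^esub> ?x"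
    using V.smult_l_distr[of r "- s" ?x] x by (simp add: class_field_def)
  also have "\<dots> = (s - s) \<odot>\<^bsub>V\<^esub> ?x"
    using V.smult_l_distr[of s "- s" ?x] x by (simp add: class_field_def eq)
  also have "\<dots> = \<zero>\<^bsub>V\<^esub>"
    using V.smult_l_null[of ?x] x by (simp add: class_field_def)
  finally have "inverse (r - s) \<odot>\<^bsub>V\<^esub> ((r - s) \<odot>\<^bsub>V\<^esub> ?x) = \<zero>\<^bsub>V\<^esub>"
    by (simp add: class_field_def)
  then have "?x = \<zero>\<^bsub>V\<^esub>"
    using V.smult_assoc1[of "inverse (r - s)" "r - s" ?x] V.smult_one[of ?x] x \<open>r \<noteq> s\<close>
    by (simp add: class_field_def)
  then show False using norm_phi_eq_unit assms zero_V by simp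
qed

lemma norm_phi_scale_le_iff:
  assumes "a \<in> G" "a \<noteq> \<e>" "0 \<le> t" "0 \<le> u"
  shows "norm (\<phi> (t \<otimes>\<^sub>g a)) \<le> norm (\<phi> (u \<otimes>\<^sub>g a)) \<longleftrightarrow> t \<le> u"
proof
  assume le: "norm (\<phi> (t \<otimes>\<^sub>g a)) \<le> norm (\<phi> (u \<otimes>\<^sub>g a))"
  show "t \<le> u"
  proof (rule ccontr)
    assume "\<not> t \<le> u"
    then have "norm (\<phi> (u \<otimes>\<^sub>g a)) = norm (\<phi> (t \<otimes>\<^sub>g a))"
      using le norm_phi_scale_mono[of a u t] assms by simp
    then have "u = t"
      using norm_phi_scale_inject[of a u t] assms by (simp add: ggv7)
    with \<open>\<not> t \<le> u\<close> show False by simp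
  qed
qed (use assms norm_phi_scale_mono in blast)

lemma norm_phi_unit_le: "a \<in> G \<Longrightarrow> norm (\<phi> \<e>) \<le> norm (\<phi> a)"
  using norm_phi_scale_mono[of a 0 1] ggv1[of a] by simp

text \<open>If the coordinate of \<open>norm (\<phi> b)\<close> were negative, a multiple of \<open>a\<close> and \<open>b\<close> would have norms
  cancelling each other in \<open>V\<close>; by (GGV8) their sum is then the unit, so their norms coincide.\<close>
lemma norm_phi_coordinate:
  assumes "a \<in> G" "a \<noteq> \<e>" "b \<in> G"
  obtains r where "0 \<le> r" "norm (\<phi> b) = norm (\<phi> (r \<otimes>\<^sub>g a))"
proof -
  interpret V: vectorspace "class_field :: real ring" V by (rule ggvv_vectorspace)
  let ?x = "norm (\<phi> a)"
  have x: "?x \<in> carrier V" "?x \<noteq> \<zero>\<^bsub>V\<^esub>"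
    using assms norm_phi_carrier norm_phi_eq_unit by (auto simp: zero_V)
  obtain r where r: "norm (\<phi> b) = r \<odot>\<^bsub>V\<^esub> ?x"
    using scalar_coordinate[OF x norm_phi_carrier[OF assms(3)]] .
  have "0 \<le> r"
  proof (rule ccontr)
    assume neg: "\<not> 0 \<le> r"
    let ?c = "\<bar>r\<bar> \<otimes>\<^sub>g a"
    have "norm (\<phi> (?c \<oplus>\<^sub>g b)) \<le> norm (\<phi> ?c) \<oplus>\<^bsub>V\<^esub> norm (\<phi> b)"
      using ggv8 assms by simp
    also have "\<dots> = (\<bar>r\<bar> + r) \<odot>\<^bsub>V\<^esub> ?x"
      using V.smult_l_distr[of "\<bar>r\<bar>" r ?x] x assms by (simp add: class_field_def ggv7 r)
    also have "\<dots> = norm (\<phi> \<e>)"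
      using V.smult_l_null[of ?x] x neg by (simp add: class_field_def zero_V)
    finally have le: "norm (\<phi> (?c \<oplus>\<^sub>g b)) \<le> norm (\<phi> \<e>)" .
    have "?c \<oplus>\<^sub>g b \<in> G" using assms by simp
    then have "?c \<oplus>\<^sub>g b = \<e>"
      using le by (intro norm_phi_eq_unit antisym norm_phi_unit_le)
    then have "b = \<ominus>\<^sub>g ?c" using gneg_unique[of ?c b] assms by simp
    then have "r \<odot>\<^bsub>V\<^esub> ?x = \<bar>r\<bar> \<odot>\<^bsub>V\<^esub> ?x"
      using r assms by (simp add: ggv7)
    then show False using norm_phi_scale_inject[of a r "\<bar>r\<bar>"] assms neg by simp
  qed
  then show ?thesis using that r assms by (simp add: ggv7)
qed

text \<open>The last clause makes \<open>N\<close> a strictly increasing function of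
  \<open>norm (\<phi> a)\<close>, so equalities between values of \<open>\<rho>\<close> carry over
  to \<open>N\<close>.\<close>

definition gyronorm :: "('a \<Rightarrow> real) \<Rightarrow> bool" where
  "gyronorm N \<longleftrightarrow>
     (\<forall>a\<in>G. 0 \<le> N a \<and> (N a = 0 \<longrightarrow> a = \<e>)) \<and>
     (\<forall>a\<in>G. \<forall>b\<in>G. N (a \<oplus>\<^sub>g b) \<le> N a + N b) \<and>
     (\<forall>r. \<forall>a\<in>G. N (r \<otimes>\<^sub>g a) = \<bar>r\<bar> * N a) \<and>
     (\<forall>a\<in>G. \<forall>b\<in>G. N a \<le> N b \<longleftrightarrow> norm (\<phi> a) \<le> norm (\<phi> b))"

lemma gyronorm_exists: "\<exists>N. gyronorm N"
proof (cases "G = {\<e>}")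
  case True
  \<comment> \<open>There is no element besides the unit to serve as a scale, and the zero function
    qualifies.\<close>
  then have "gyronorm (\<lambda>_. 0)" unfolding gyronorm_def by auto
  then show ?thesis by blast
next
  case False
  interpret V: vectorspace "class_field :: real ring" V by (rule ggvv_vectorspace)
  obtain a where a: "a \<in> G" "a \<noteq> \<e>" using False unit_closed by blast
  have ax: "norm (\<phi> a) \<in> carrier V" using a norm_phi_carrier by simp
  \<comment> \<open>\<open>N b\<close> is the coordinate of \<open>norm (\<phi> b)\<close> in units
    of the fixed \<open>a\<close>; it exists by \<open>norm_phi_coordinate\<close> and is unique by
    \<open>eq\<close>.\<close>
  define N where "N b = (SOME r. 0 \<le> r \<and> norm (\<phi> b) = norm (\<phi> (r \<otimes>\<^sub>g a)))" for b
  have N: "0 \<le> N b \<and> norm (\<phi> b) = norm (\<phi> (N b \<otimes>\<^sub>g a))" if "b \<in> G" for b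
    unfolding N_def by (rule someI_ex) (use norm_phi_coordinate[OF a that] in blast)
  have le: "N b \<le> t \<longleftrightarrow> norm (\<phi> b) \<le> norm (\<phi> (t \<otimes>\<^sub>g a))" if "b \<in> G" "0 \<le> t" for b t
    using norm_phi_scale_le_iff[OF a, of "N b" t] N[OF that(1)] that by simp
  have eq: "N b = t" if "b \<in> G" "0 \<le> t" "norm (\<phi> b) = norm (\<phi> (t \<otimes>\<^sub>g a))" for b t
    using norm_phi_scale_inject[OF a, of "N b" t] N[OF that(1)] that a by (simp add: ggv7)
  have "gyronorm N"
    unfolding gyronorm_def
  proof (intro conjI ballI allI impI)
    fix b assume b: "b \<in> G"
    show "0 \<le> N b" using N b by blast
    show "b = \<e>" if "N b = 0"
      using N[OF b] that a b norm_phi_eq_unit[of b] by simp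
    show "N (r \<otimes>\<^sub>g b) = \<bar>r\<bar> * N b" for r
    proof (rule eq)
      have "norm (\<phi> (r \<otimes>\<^sub>g b)) = norm (\<phi> (\<bar>r\<bar> \<otimes>\<^sub>g (N b \<otimes>\<^sub>g a)))"
        using N[OF b] a b by (simp only: ggv7 gscale_closed abs_abs)
      then show "norm (\<phi> (r \<otimes>\<^sub>g b)) = norm (\<phi> ((\<bar>r\<bar> * N b) \<otimes>\<^sub>g a))"
        using a by (simp add: ggv3)
    qed (use b N in auto)
    fix c assume c: "c \<in> G"
    show "N b \<le> N c \<longleftrightarrow> norm (\<phi> b) \<le> norm (\<phi> c)"
      using le[OF b, of "N c"] N[OF c] by simp
    have "norm (\<phi> (b \<oplus>\<^sub>g c)) \<le> norm (\<phi> (N b \<otimes>\<^sub>g a)) \<oplus>\<^bsub>V\<^esub> norm (\<phi> (N c \<otimes>\<^sub>g a))"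
      using ggv8[of b c] N b c by simp
    also have "\<dots> = norm (\<phi> ((N b + N c) \<otimes>\<^sub>g a))"
      using V.smult_l_distr[of "N b" "N c" "norm (\<phi> a)"] ax a N[OF b] N[OF c]
      by (simp add: class_field_def ggv7)
    finally show "N (b \<oplus>\<^sub>g c) \<le> N b + N c"
      using le[of "b \<oplus>\<^sub>g c" "N b + N c"] b c N[OF b] N[OF c] by simp
  qed
  then show ?thesis by blast
qed

lemma gyronorm_cong:
  assumes "gyronorm N" "a \<in> G" "b \<in> G" "norm (\<phi> a) = norm (\<phi> b)"
  shows "N a = N b"
  using assms unfolding gyronorm_def by (metis order_antisym order_refl)

text \<open>Translating by \<open>\<ominus>\<^sub>g y\<close> puts \<open>y\<close> at the unit,
  where subadditivity of \<open>N\<close> applies directly.\<close>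

lemma gyronorm_gyrometric_triangle:
  assumes N: "gyronorm N" and "x \<in> G" "y \<in> G" "z \<in> G"
  shows "N (x \<oplus>\<^sub>g (\<ominus>\<^sub>g z)) \<le> N (x \<oplus>\<^sub>g (\<ominus>\<^sub>g y)) + N (y \<oplus>\<^sub>g (\<ominus>\<^sub>g z))"
proof -
  let ?u = "\<ominus>\<^sub>g y \<oplus>\<^sub>g x" and ?v = "\<ominus>\<^sub>g y \<oplus>\<^sub>g z"
  have "N (x \<oplus>\<^sub>g (\<ominus>\<^sub>g z)) = N (?u \<oplus>\<^sub>g (\<ominus>\<^sub>g ?v))"
    by (rule gyronorm_cong[OF N])
      (use assms gyrometric_left_translation[of "\<ominus>\<^sub>g y" x z] in \<open>simp_all add: gyrometric_def\<close>)
  also have "\<dots> \<le> N ?u + N (\<ominus>\<^sub>g ?v)"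
    using N assms by (simp add: gyronorm_def)
  also have "N ?u = N (x \<oplus>\<^sub>g (\<ominus>\<^sub>g y))"
    by (rule gyronorm_cong[OF N])
      (use assms gyrometric_left_translation[of "\<ominus>\<^sub>g y" x y] in \<open>simp_all add: gyrometric_def\<close>)
  also have "N (\<ominus>\<^sub>g ?v) = N (y \<oplus>\<^sub>g (\<ominus>\<^sub>g z))"
    using assms by (simp add: automorphic_inverse)
  finally show ?thesis .
qed

text \<open>Up to translation by \<open>z\<close>, the reflected point and \<open>x\<close> are
  \<open>?w\<close> and its inverse, whose difference is
  \<open>2 \<otimes>\<^sub>g ?w\<close>.\<close>

lemma gyronorm_reflection:
  assumes N: "gyronorm N" and "z \<in> G" "x \<in> G"
  shows "N (reflection z x \<oplus>\<^sub>g (\<ominus>\<^sub>g x)) = 2 * N (x \<oplus>\<^sub>g (\<ominus>\<^sub>g z))"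
proof -
  let ?w = "z \<oplus>\<^sub>g (\<ominus>\<^sub>g x)"
  have x: "x = z \<oplus>\<^sub>g (\<ominus>\<^sub>g ?w)" using assms by (simp add: automorphic_inverse)
  have "N (reflection z x \<oplus>\<^sub>g (\<ominus>\<^sub>g x)) = N (2 \<otimes>\<^sub>g ?w)"
  proof (rule gyronorm_cong[OF N])
    have "\<rho> (reflection z x) x = \<rho> (z \<oplus>\<^sub>g ?w) (z \<oplus>\<^sub>g (\<ominus>\<^sub>g ?w))"
      using assms by (simp add: reflection_def automorphic_inverse)
    also have "\<dots> = \<rho> ?w (\<ominus>\<^sub>g ?w)"
      by (rule gyrometric_left_translation) (use assms in simp_all)
    also have "\<dots> = norm (\<phi> (?w \<oplus>\<^sub>g ?w))"
      using assms by (simp only: gneg_gneg closed gyrometric_def)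
    finally show "norm (\<phi> (reflection z x \<oplus>\<^sub>g (\<ominus>\<^sub>g x))) = norm (\<phi> (2 \<otimes>\<^sub>g ?w))"
      using assms by (simp add: gyrometric_def scale_two)
  qed (use assms in auto)
  also have "\<dots> = 2 * N ?w" using N assms by (simp add: gyronorm_def)
  also have "N ?w = N (x \<oplus>\<^sub>g (\<ominus>\<^sub>g z))"
    by (rule gyronorm_cong[OF N])
      (use assms norm_gneg[of ?w] in \<open>simp_all add: automorphic_inverse gyrocomm[of x] ggv0\<close>)
  finally show ?thesis .
qed

section \<open>Fixed points of reflections and of isometries\<close>

lemma reflection_fixed_point:
  assumes "z \<in> G" "x \<in> G" "reflection z x = x"
  shows "x = z"
proof -
  obtain N where N: "gyronorm N" using gyronorm_exists by blast
  have "N \<e> = 0" using N scale_zero[OF unit_closed] unit_closed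
    unfolding gyronorm_def by (metis abs_zero mult_zero_left)
  \<comment> \<open>A fixed point has displacement zero, whereas a reflection moves it by twice its
    distance from \<open>z\<close>.\<close>
  then have "N (x \<oplus>\<^sub>g (\<ominus>\<^sub>g z)) = 0"
    using gyronorm_reflection[OF N assms(1,2)] assms by simp
  then have "x \<oplus>\<^sub>g (\<ominus>\<^sub>g z) = \<e>" using N assms by (simp add: gyronorm_def)
  then show ?thesis using gadd_gneg_eq_unit assms by simp
qed

text \<open>Vaisala's argument: conjugating by the reflection doubles the displacement of \<open>z\<close>, while
  the displacement stays bounded because the endpoints are fixed.\<close>
lemma isometry_fixes_midpoint:
  assumes z: "z \<in> G" and a: "a \<in> G"
    and bij: "bij_betw g G G"
    and iso: "\<And>x y. \<lbrakk>x \<in> G; y \<in> G\<rbrakk> \<Longrightarrow> \<rho> (g x) (g y) = \<rho> x y"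
    and fixed: "g a = a" "g (reflection z a) = reflection z a"
  shows "g z = z"
proof -
  obtain N where N: "gyronorm N" using gyronorm_exists by blast
  define d where "d x y = N (x \<oplus>\<^sub>g (\<ominus>\<^sub>g y))" for x y
  have dcong: "d x y = d u v" if "x \<in> G" "y \<in> G" "u \<in> G" "v \<in> G" "\<rho> x y = \<rho> u v" for x y u v
    unfolding d_def by (rule gyronorm_cong[OF N]) (use that in \<open>auto simp: gyrometric_def\<close>)
  have triangle: "d x w \<le> d x y + d y w" if "x \<in> G" "y \<in> G" "w \<in> G" for x y w
    unfolding d_def using gyronorm_gyrometric_triangle[OF N] that by simp
  have double: "d (reflection z x) x = 2 * d x z" if "x \<in> G" for x
    unfolding d_def using gyronorm_reflection[OF N z that] .
  let ?b = "reflection z a"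
  \<comment> \<open>The bound is stated for every such \<open>g\<close>, because the induction step
    applies it to another isometry.\<close>
  have bound: "2 ^ n * d (g z) z \<le> d z a + d a z"
    if "bij_betw g G G" "\<And>x y. \<lbrakk>x \<in> G; y \<in> G\<rbrakk> \<Longrightarrow> \<rho> (g x) (g y) = \<rho> x y" "g a = a" "g ?b = ?b"
    for n g using that
  proof (induction n arbitrary: g)
    case 0
    have gz: "g z \<in> G" using 0 z bij_betw_apply by metis
    then have "d (g z) z \<le> d (g z) (g a) + d a z"
      using triangle[of "g z" a z] z a 0 by simp
    moreover have "d (g z) (g a) = d z a"
      using 0(2)[OF z a] 0(3) gz z a by (intro dcong) simp_all
    ultimately show ?case by simp
  next
    case (Suc n)
    let ?i = "inv_into G g"
    \<comment> \<open>This map is again an isometry and fixes both endpoints: \<open>g\<close> and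
      its inverse fix them, and the two reflections swap them twice.\<close>
    let ?h = "\<lambda>x. reflection z (?i (reflection z (g x)))"
    have g: "g x \<in> G" if "x \<in> G" for x using Suc.prems(1) that bij_betw_apply by metis
    have i: "?i x \<in> G" "g (?i x) = x" if "x \<in> G" for x
      using Suc.prems(1) that by (auto simp: bij_betw_def inv_into_into f_inv_into_f)
    have i': "?i (g x) = x" if "x \<in> G" for x
      using Suc.prems(1) that by (simp add: bij_betw_def)
    have iiso: "\<rho> (?i x) (?i y) = \<rho> x y" if "x \<in> G" "y \<in> G" for x y
      using Suc.prems(2)[of "?i x" "?i y"] i that by simp
    have refl: "bij_betw (reflection z) G G"
      by (rule bij_betw_byWitness[where f' = "reflection z"]) (use z in auto)
    have "bij_betw ?h G G"
      using bij_betw_trans[OF bij_betw_trans[OF Suc.prems(1) refl]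
          bij_betw_trans[OF bij_betw_inv_into[OF Suc.prems(1)] refl]] by (simp add: comp_def)
    moreover have "\<rho> (?h x) (?h y) = \<rho> x y" if "x \<in> G" "y \<in> G" for x y
      using that z g i by (simp add: gyrometric_reflection iiso Suc.prems(2))
    moreover have "?h a = a" "?h ?b = ?b"
      using i'[of ?b] i'[of a] Suc.prems(3,4) z a by simp_all
    ultimately have "2 ^ n * d (?h z) z \<le> d z a + d a z"
      by (rule Suc.IH)
    moreover have "d (?h z) z = d (reflection z (g z)) (g z)"
    proof (rule dcong)
      have "\<rho> (?h z) z = \<rho> (?h z) (reflection z z)" using z by simp
      also have "\<dots> = \<rho> (?i (reflection z (g z))) (?i (g z))"
        using z g i i' by (simp add: gyrometric_reflection del: reflection_self)
      also have "\<dots> = \<rho> (reflection z (g z)) (g z)" using z g by (simp add: iiso)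
      finally show "\<rho> (?h z) z = \<rho> (reflection z (g z)) (g z)" .
    qed (use z g i in auto)
    ultimately show ?case using double[OF g[OF z]] by simp
  qed
  have gz: "g z \<in> G" using bij z bij_betw_apply by metis
  have "d (g z) z = 0"
  proof (rule ccontr)
    assume "d (g z) z \<noteq> 0"
    then have pos: "0 < d (g z) z" using N gz z by (simp add: d_def gyronorm_def less_le)
    obtain n :: nat where "(d z a + d a z) / d (g z) z < 2 ^ n"
      using real_arch_pow[of 2] by auto
    then show False using bound[OF bij iso fixed, of n] pos by (simp add: field_simps)
  qed
  then have "g z \<oplus>\<^sub>g (\<ominus>\<^sub>g z) = \<e>" using N gz z by (simp add: d_def gyronorm_def)
  then show ?thesis using gadd_gneg_eq_unit gz z by simp
qed

end

section \<open>Surjective isometries between two spaces\<close>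

locale gyrometric_isometry =
  A: ggv G1 add1 e1 neg1 gyr1 scale1 \<phi>1 V1 + B: ggv G2 add2 e2 neg2 gyr2 scale2 \<phi>2 V2
  for G1 :: "'a set" and G2 :: "'b set"
    and add1 (infixl "\<oplus>\<^sub>1" 65) and add2 (infixl "\<oplus>\<^sub>2" 65)
    and e1 e2
    and neg1 ("\<ominus>\<^sub>1 _" [81] 80) and neg2 ("\<ominus>\<^sub>2 _" [81] 80)
    and gyr1 gyr2
    and scale1 (infixr "\<otimes>\<^sub>1" 75) and scale2 (infixr "\<otimes>\<^sub>2" 75)
    and \<phi>1 :: "'a \<Rightarrow> 'v :: real_normed_vector"
    and \<phi>2 :: "'b \<Rightarrow> 'w :: real_normed_vector"
    and V1 V2 +
  fixes T :: "'a \<Rightarrow> 'b"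
  assumes surj: "T ` G1 = G2"
    and isometry: "\<lbrakk>a \<in> G1; b \<in> G1\<rbrakk> \<Longrightarrow> B.gyrometric (T a) (T b) = A.gyrometric a b"
begin

lemma T_closed [simp]: "a \<in> G1 \<Longrightarrow> T a \<in> G2"
  using surj by blast

lemma norm_units_eq: "norm (\<phi>2 e2) = norm (\<phi>1 e1)"
  using isometry[of e1 e1] by (simp add: A.gyrometric_def B.gyrometric_def)

text \<open>Two points coincide exactly when their distance is the norm of the unit, and this number
  is the same in both spaces.\<close>

lemma bij: "bij_betw T G1 G2"
proof (rule bij_betwI')
  fix a b assume "a \<in> G1" "b \<in> G1"
  then show "T a = T b \<longleftrightarrow> a = b"
    using isometry[of a b] A.gyrometric_eq_norm_unit[of a b]
      B.gyrometric_eq_norm_unit[of "T a" "T b"] norm_units_eq by simp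
qed (use surj in auto)

text \<open>With \<open>w\<close> a midpoint of the images of \<open>a\<close> and
  \<open>?b\<close>, the claim amounts to \<open>T z = w\<close>. Pulling the reflection at
  \<open>w\<close> back along \<open>T\<close> and composing with the reflection at \<open>z\<close>
  gives an isometry of \<open>G1\<close> fixing \<open>a\<close> and \<open>?b\<close>, hence
  \<open>z\<close>; so the reflection at \<open>w\<close> fixes \<open>T z\<close>.\<close>

lemma map_reflection:
  assumes z: "z \<in> G1" and a: "a \<in> G1"
  shows "T (A.reflection z a) = B.reflection (T z) (T a)"
proof -
  let ?S = "inv_into G1 T" and ?b = "A.reflection z a"
  have b: "?b \<in> G1" using assms by simp
  obtain w where w: "w \<in> G2" "B.reflection w (T a) = T ?b"
    using B.exists_reflection[of "T a" "T ?b"] assms by auto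
  have w': "B.reflection w (T ?b) = T a"
    using B.reflection_reflection[of w "T a"] w a by simp
  have S: "?S y \<in> G1" "T (?S y) = y" if "y \<in> G2" for y
    using that surj by (auto simp: inv_into_into f_inv_into_f)
  have S': "?S (T x) = x" if "x \<in> G1" for x
    using bij that by (simp add: bij_betw_def)
  have Siso: "A.gyrometric (?S x) (?S y) = B.gyrometric x y" if "x \<in> G2" "y \<in> G2" for x y
    using isometry[of "?S x" "?S y"] S that by simp
  let ?g = "\<lambda>x. A.reflection z (?S (B.reflection w (T x)))"
  have "?g z = z"
  proof (rule A.isometry_fixes_midpoint[OF z a, where g = ?g])
    have refl1: "bij_betw (A.reflection z) G1 G1"
      by (rule bij_betw_byWitness[where f' = "A.reflection z"]) (use z in auto)
    have refl2: "bij_betw (B.reflection w) G2 G2"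
      by (rule bij_betw_byWitness[where f' = "B.reflection w"]) (use w in auto)
    show "bij_betw ?g G1 G1"
      using bij_betw_trans[OF bij_betw_trans[OF bij refl2]
          bij_betw_trans[OF bij_betw_inv_into[OF bij] refl1]] by (simp add: comp_def)
    show "A.gyrometric (?g x) (?g y) = A.gyrometric x y" if "x \<in> G1" "y \<in> G1" for x y
      using that z w S by (simp add: A.gyrometric_reflection Siso B.gyrometric_reflection isometry)
    show "?g a = a" using w S'[OF b] z a by simp
    show "?g ?b = ?b" using w' S'[OF a] by simp
  qed
  then have "A.reflection z (?g z) = A.reflection z z" by simp
  then have "?S (B.reflection w (T z)) = z" using z w S by simp
  then have "B.reflection w (T z) = T z" using S(2)[of "B.reflection w (T z)"] z w by simp
  then have "T z = w" using B.reflection_fixed_point[of w "T z"] z w by simp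
  then show ?thesis using w by simp
qed

end

section \<open>Unit-preserving isometries respect addition and scalar multiplication\<close>

locale unital_gyrometric_isometry = gyrometric_isometry +
  assumes map_unit [simp]: "T e1 = e2"
begin

text \<open>Inversion is the reflection at the unit.\<close>

lemma map_neg: "a \<in> G1 \<Longrightarrow> T (\<ominus>\<^sub>1 a) = \<ominus>\<^sub>2 (T a)"
  using map_reflection[of e1 a] by (simp add: A.reflection_def B.reflection_def)

text \<open>Doubling \<open>a\<close> is reflecting the unit at \<open>a\<close>.\<close>

lemma map_double: "a \<in> G1 \<Longrightarrow> T (a \<oplus>\<^sub>1 a) = T a \<oplus>\<^sub>2 T a"
  using map_reflection[of a e1] by (simp add: A.reflection_def B.reflection_def)

lemma norm_map: "a \<in> G1 \<Longrightarrow> norm (\<phi>2 (T a)) = norm (\<phi>1 a)"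
  using isometry[of a e1] by (simp add: A.gyrometric_def B.gyrometric_def)

text \<open>With \<open>a = h \<oplus> h\<close>, the sum \<open>a \<oplus> b\<close> is the reflection of \<open>\<ominus> b\<close> at \<open>h\<close>.\<close>
lemma map_add:
  assumes "a \<in> G1" "b \<in> G1"
  shows "T (a \<oplus>\<^sub>1 b) = T a \<oplus>\<^sub>2 T b"
proof -
  define h where "h = (1/2) \<otimes>\<^sub>1 a"
  have h: "h \<in> G1" using assms by (simp add: h_def)
  have a: "a = h \<oplus>\<^sub>1 h"
    using A.ggv3[of a 2 "1/2"] A.scale_two[OF h] assms by (simp add: h_def A.ggv1)
  \<comment> \<open>Rebracketing is allowed because \<open>gyr h h\<close> is the identity by
    (GGV6).\<close>
  have "a \<oplus>\<^sub>1 b = A.reflection h (\<ominus>\<^sub>1 b)"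
    using A.left_gyroassoc[of h h b] h assms by (simp add: a A.reflection_def)
  then have "T (a \<oplus>\<^sub>1 b) = B.reflection (T h) (\<ominus>\<^sub>2 (T b))"
    using h assms by (simp add: map_reflection map_neg)
  also have "\<dots> = (T h \<oplus>\<^sub>2 T h) \<oplus>\<^sub>2 T b"
    using B.left_gyroassoc[of "T h" "T h" "T b"] h assms by (simp add: B.reflection_def)
  finally show ?thesis using h by (simp add: a map_double)
qed

lemma map_scale_nat:
  assumes "a \<in> G1"
  shows "T (real n \<otimes>\<^sub>1 a) = real n \<otimes>\<^sub>2 T a"
proof (induction n)
  case (Suc n)
  have "real (Suc n) \<otimes>\<^sub>1 a = real n \<otimes>\<^sub>1 a \<oplus>\<^sub>1 a"
    using A.ggv2[of a "real n" 1] assms by (simp add: A.ggv1 add.commute)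
  moreover have "real (Suc n) \<otimes>\<^sub>2 T a = real n \<otimes>\<^sub>2 T a \<oplus>\<^sub>2 T a"
    using B.ggv2[of "T a" "real n" 1] assms by (simp add: B.ggv1 add.commute)
  ultimately show ?case using Suc map_add assms by simp
qed (use assms in simp)

lemma map_scale_int:
  assumes "a \<in> G1"
  shows "T (of_int k \<otimes>\<^sub>1 a) = of_int k \<otimes>\<^sub>2 T a"
proof (cases k rule: int_cases2)
  case (nonneg n)
  then show ?thesis using map_scale_nat[OF assms, of n] by simp
next
  case (nonpos n)
  have "of_int k \<otimes>\<^sub>1 a = \<ominus>\<^sub>1 (real n \<otimes>\<^sub>1 a)"
    using A.ggv3[of a "-1" "real n"] A.scale_neg_one[of "real n \<otimes>\<^sub>1 a"] assms nonpos by simp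
  moreover have "of_int k \<otimes>\<^sub>2 T a = \<ominus>\<^sub>2 (real n \<otimes>\<^sub>2 T a)"
    using B.ggv3[of "T a" "-1" "real n"] B.scale_neg_one[of "real n \<otimes>\<^sub>2 T a"] assms nonpos by simp
  ultimately show ?thesis using map_scale_nat[OF assms, of n] map_neg assms by simp
qed

lemma map_scale_inverse_nat:
  assumes "a \<in> G1" "n \<noteq> 0"
  shows "T ((1 / real n) \<otimes>\<^sub>1 a) = (1 / real n) \<otimes>\<^sub>2 T a"
proof -
  let ?c = "(1 / real n) \<otimes>\<^sub>1 a"
  have "T a = T (real n \<otimes>\<^sub>1 ?c)"
    using A.ggv3[of a "real n" "1 / real n"] assms by (simp add: A.ggv1)
  also have "\<dots> = real n \<otimes>\<^sub>2 T ?c" using map_scale_nat assms by simp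
  finally have "(1 / real n) \<otimes>\<^sub>2 T a = ((1 / real n) * real n) \<otimes>\<^sub>2 T ?c"
    using B.ggv3[of "T ?c" "1 / real n" "real n"] assms by simp
  then show ?thesis using assms by (simp add: B.ggv1)
qed

text \<open>The norms of the two spaces are related only through an unknown increasing function, but
  monotonicity suffices to bound \<open>T (t \<otimes> a)\<close> for \<open>0 \<le> t \<le> 1 / n\<close> by \<open>T ((1 / n) \<otimes> a)\<close>, which
  carries over the homogeneity from the multiples of \<open>1 / n\<close> to all reals.\<close>
lemma map_scale:
  assumes a: "a \<in> G1"
  shows "T (r \<otimes>\<^sub>1 a) = r \<otimes>\<^sub>2 T a"
proof -
  obtain N where N: "B.gyronorm N" using B.gyronorm_exists by blast
  have Nscale: "N (t \<otimes>\<^sub>2 y) = \<bar>t\<bar> * N y" if "y \<in> G2" for t y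
    using N that by (simp add: B.gyronorm_def)
  let ?x = "T (r \<otimes>\<^sub>1 a)" and ?y = "r \<otimes>\<^sub>2 T a"
  have bound: "N (?x \<oplus>\<^sub>2 (\<ominus>\<^sub>2 ?y)) \<le> 2 * N (T a) / real n" if n: "n \<noteq> 0" for n
  proof -
    \<comment> \<open>\<open>q\<close> is the largest multiple of \<open>1 / n\<close> not exceeding
      \<open>r\<close>, which leaves a remainder \<open>t\<close> between 0 and
      \<open>1 / n\<close>.\<close>
    define k where "k = \<lfloor>real n * r\<rfloor>"
    define q where "q = of_int k * (1 / real n)"
    define t where "t = r - q"
    have "of_int k \<le> real n * r" "real n * r \<le> of_int k + 1"
      unfolding k_def by linarith+
    then have "of_int k / real n \<le> r" "r \<le> (of_int k + 1) / real n"
      using n by (simp_all add: pos_divide_le_eq pos_le_divide_eq mult.commute)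
    then have t: "0 \<le> t" "t \<le> 1 / real n"
      by (simp_all add: t_def q_def add_divide_distrib)
    have q: "T (q \<otimes>\<^sub>1 a) = q \<otimes>\<^sub>2 T a"
      using a n by (simp only: q_def A.ggv3 B.ggv3 T_closed A.gscale_closed map_scale_int map_scale_inverse_nat[OF a n])
    have x: "?x = q \<otimes>\<^sub>2 T a \<oplus>\<^sub>2 T (t \<otimes>\<^sub>1 a)"
      using A.ggv2[of a q t] a q by (simp add: map_add t_def)
    have y: "?y = q \<otimes>\<^sub>2 T a \<oplus>\<^sub>2 t \<otimes>\<^sub>2 T a"
      using B.ggv2[of "T a" q t] a by (simp add: t_def)
    \<comment> \<open>The common left summand drops out up to a gyration, so only the remainders are
      compared.\<close>
    have "N (?x \<oplus>\<^sub>2 (\<ominus>\<^sub>2 ?y)) = N (T (t \<otimes>\<^sub>1 a) \<oplus>\<^sub>2 (\<ominus>\<^sub>2 (t \<otimes>\<^sub>2 T a)))"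
      by (rule B.gyronorm_cong[OF N])
        (use a in \<open>simp_all add: x y B.left_translation_difference B.ggv0\<close>)
    also have "\<dots> \<le> N (T (t \<otimes>\<^sub>1 a)) + N (\<ominus>\<^sub>2 (t \<otimes>\<^sub>2 T a))"
      using N a by (simp add: B.gyronorm_def)
    also have "N (\<ominus>\<^sub>2 (t \<otimes>\<^sub>2 T a)) = t * N (T a)"
      using B.gyronorm_cong[OF N, of "\<ominus>\<^sub>2 (t \<otimes>\<^sub>2 T a)" "t \<otimes>\<^sub>2 T a"] a t by (simp add: Nscale)
    also have "N (T (t \<otimes>\<^sub>1 a)) \<le> N (T ((1 / real n) \<otimes>\<^sub>1 a))"
      using N A.norm_phi_scale_mono[of a t "1 / real n"] t a
      by (simp add: B.gyronorm_def norm_map)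
    also have "\<dots> = N (T a) / real n"
      using a n by (simp add: map_scale_inverse_nat Nscale)
    also have "t * N (T a) \<le> (1 / real n) * N (T a)"
      using t N a by (intro mult_right_mono) (auto simp: B.gyronorm_def)
    finally show ?thesis by simp
  qed
  have nonneg: "0 \<le> N (?x \<oplus>\<^sub>2 (\<ominus>\<^sub>2 ?y))" using N a by (simp add: B.gyronorm_def)
  have "N (?x \<oplus>\<^sub>2 (\<ominus>\<^sub>2 ?y)) = 0"
  proof (rule ccontr)
    assume "N (?x \<oplus>\<^sub>2 (\<ominus>\<^sub>2 ?y)) \<noteq> 0"
    then have pos: "0 < N (?x \<oplus>\<^sub>2 (\<ominus>\<^sub>2 ?y))" using nonneg by simp
    then obtain n :: nat where n: "2 * N (T a) < real n * N (?x \<oplus>\<^sub>2 (\<ominus>\<^sub>2 ?y))"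
      using reals_Archimedean3 by blast
    moreover have "0 \<le> N (T a)" using N a by (simp add: B.gyronorm_def)
    \<comment> \<open>For \<open>n = 0\<close> the strict inequality would make
      \<open>N (T a)\<close> negative.\<close>
    ultimately have "n \<noteq> 0" by (cases n) auto
    then show False using bound[of n] n by (simp add: field_simps)
  qed
  then have "?x \<oplus>\<^sub>2 (\<ominus>\<^sub>2 ?y) = e2" using N a by (simp add: B.gyronorm_def)
  then show ?thesis using B.gadd_gneg_eq_unit[of ?x ?y] a by simp
qed

end

section \<open>Reduction of the general case to unit-preserving isometries\<close>

theorem corollary4p5:
  fixes G1 :: "'a set" and G2 :: "'b set"
    and add1 :: "'a \<Rightarrow> 'a \<Rightarrow> 'a" (infixl "\<oplus>\<^sub>1" 65)
    and add2 :: "'b \<Rightarrow> 'b \<Rightarrow> 'b" (infixl "\<oplus>\<^sub>2" 65)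
    and e1 :: 'a and e2 :: 'b
    and neg1 :: "'a \<Rightarrow> 'a" and neg2 :: "'b \<Rightarrow> 'b"
    and gyr1 :: "'a \<Rightarrow> 'a \<Rightarrow> 'a \<Rightarrow> 'a" and gyr2 :: "'b \<Rightarrow> 'b \<Rightarrow> 'b \<Rightarrow> 'b"
    and scale1 :: "real \<Rightarrow> 'a \<Rightarrow> 'a" (infixr "\<otimes>\<^sub>1" 75)
    and scale2 :: "real \<Rightarrow> 'b \<Rightarrow> 'b" (infixr "\<otimes>\<^sub>2" 75)
    and \<phi>1 :: "'a \<Rightarrow> 'v :: real_normed_vector"
    and \<phi>2 :: "'b \<Rightarrow> 'w :: real_normed_vector"
    and V1 V2 :: "(real, real) module"
    and T :: "'a \<Rightarrow> 'b"
  assumes ggv_1: "ggv G1 add1 e1 neg1 gyr1 scale1 \<phi>1 V1"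
    and ggv_2: "ggv G2 add2 e2 neg2 gyr2 scale2 \<phi>2 V2"
    and surj: "T ` G1 = G2"
    and isometry: "\<And>a b. \<lbrakk>a \<in> G1; b \<in> G1\<rbrakk> \<Longrightarrow>
          ggv.gyrometric add2 neg2 \<phi>2 (T a) (T b) = ggv.gyrometric add1 neg1 \<phi>1 a b"
  shows "\<exists>T\<^sub>0. (\<forall>a\<in>G1. T a = T e1 \<oplus>\<^sub>2 T\<^sub>0 a)
           \<and> bij_betw T\<^sub>0 G1 G2
           \<and> (\<forall>a\<in>G1. \<forall>b\<in>G1. T\<^sub>0 (a \<oplus>\<^sub>1 b) = T\<^sub>0 a \<oplus>\<^sub>2 T\<^sub>0 b)
           \<and> (\<forall>r. \<forall>a\<in>G1. T\<^sub>0 (r \<otimes>\<^sub>1 a) = r \<otimes>\<^sub>2 T\<^sub>0 a)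
           \<and> (\<forall>a\<in>G1. \<forall>b\<in>G1. ggv.gyrometric add2 neg2 \<phi>2 (T\<^sub>0 a) (T\<^sub>0 b)
                 = ggv.gyrometric add1 neg1 \<phi>1 a b)"
proof -
  interpret gyrometric_isometry G1 G2 add1 add2 e1 e2 neg1 neg2 gyr1 gyr2 scale1 scale2 \<phi>1 \<phi>2 V1 V2 T
    using assms by (intro gyrometric_isometry.intro gyrometric_isometry_axioms.intro)
  \<comment> \<open>Translating by the inverse of \<open>T e1\<close> sends the image of
    \<open>e1\<close> to \<open>e2\<close> and preserves distances; left cancellation recovers
    \<open>T\<close>.\<close>
  define T0 where "T0 a = neg2 (T e1) \<oplus>\<^sub>2 T a" for a
  have closed0: "T0 a \<in> G2" if "a \<in> G1" for a using that by (simp add: T0_def)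
  have iso0: "B.gyrometric (T0 a) (T0 b) = A.gyrometric a b" if "a \<in> G1" "b \<in> G1" for a b
    using that isometry by (simp add: T0_def B.gyrometric_left_translation)
  have "T0 ` G1 = G2"
  proof
    show "G2 \<subseteq> T0 ` G1"
    proof
      fix y assume y: "y \<in> G2"
      then have "T e1 \<oplus>\<^sub>2 y \<in> T ` G1" using surj by simp
      then obtain a where "a \<in> G1" "T a = T e1 \<oplus>\<^sub>2 y" by auto
      then show "y \<in> T0 ` G1" using y by (auto simp: T0_def image_iff intro!: bexI[of _ a])
    qed
  qed (use closed0 in blast)
  then interpret T0: unital_gyrometric_isometry
    G1 G2 add1 add2 e1 e2 neg1 neg2 gyr1 gyr2 scale1 scale2 \<phi>1 \<phi>2 V1 V2 T0
    using iso0 by unfold_locales (auto simp: T0_def)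
  have "T a = T e1 \<oplus>\<^sub>2 T0 a" if "a \<in> G1" for a using that by (simp add: T0_def)
  then show ?thesis
    using T0.bij T0.map_add T0.map_scale iso0 by (intro exI[of _ T0]) blast
qed

end
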